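(* Let $X$ and $Y$ be Polish spaces, $\mu\in\mathcal{P}(X)$, $\nu\in\mathcal{P}(Y)$, and let $c\colon X\times Y\to\mathbb{R}_+$ be continuous with $T_c(\mu,\nu)<\infty$. Let $\mathrm{supp}\,\mu=\bigcup_{i\in I}X_i$ and $\mathrm{supp}\,\nu=\bigcup_{j\in J}Y_j$ be the decompositions into (pairwise disjoint) connected components, and assume that $I$ is finite and $J$ is at most countable. Assume that for all $f\in S_c(\mu,\nu)$ either 1) $f^c|_{\mathrm{supp}\,\nu}$ is a (real-valued) continuous function, or 2) $f^c|_{Y_j}$ is a (real-valued) continuous function and $\mathrm{supp}(\nu|_{Y_j})$ is connected for all $j\in J$ with $\nu(Y_j)>0$. If there exists a non-degenerate optimal transport plan $\pi\in\mathcal{C}(\mu,\nu)$ with respect to which the Kantorovich potentials $S_{c_{X_i}}(\mu_{X_i},\nu_{X_i})$ of the $X_i$-restricted problem are unique for all $i\in I$, then the Kantorovich potentials $S_c(\mu,\nu)$ are also unique.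
   Context: $\mathcal{P}(X)$ is the set of Borel probability measures on $X$; $\mathcal{C}(\mu,\nu)$ is the set of probability measures on $X\times Y$ with marginals $\mu,\nu$ (transport plans); $T_c(\mu,\nu)=\inf_{\pi\in\mathcal{C}(\mu,\nu)}\int c\,\mathrm{d}\pi$, and $\pi$ is optimal if it attains this infimum. The support of a measure is the smallest closed set of full measure. $c$-transforms: for $g\colon Y\to\mathbb{R}\cup\{-\infty\}$ set $g^c(x)=\inf_{y\in Y}c(x,y)-g(y)$, and for $f\colon X\to\mathbb{R}\cup\{-\infty\}$ set $f^c(y)=\inf_{x\in X}c(x,y)-f(x)$. A function $f\colon X\to\mathbb{R}\cup\{-\infty\}$ is $c$-concave on $X$ if $f=g^c$ for some $g\colon Y\to\mathbb{R}\cup\{-\infty\}$ and $f$ is not identically $-\infty$. A (generalized) Kantorovich potential is a $c$-concave function $f$ on $X$ such that $T_c(\mu,\nu)=\int c\,\mathrm{d}\pi=\int\big(f(x)+f^c(y)\big)\,\mathrm{d}\pi(x,y)$ for an optimal plan $\pi$ (equivalently, for every optimal plan). The set of these is denoted $S_c(\mu,\nu)$; $f$ and $f^c$ need not be integrable individually. Kantorovich potentials $S_c(\mu,\nu)$ are called unique if $f_1-f_2$ is $\mu$-almost surely constant for all $f_1,f_2\in S_c(\mu,\nu)$. Restricted problem: given an optimal plan $\pi\in\mathcal{C}(\mu,\nu)$ and a closed $\tilde X\subset X$ with $\mu(\tilde X)>0$, the $\tilde X$-restricted problem (with respect to $\pi$) is the optimal transport problem between $\mu_{\tilde X}=\mu|_{\tilde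 X}/\mu(\tilde X)$ and $\nu_{\tilde X}=\pi(\tilde X\times\cdot)/\mu(\tilde X)$ under the cost $c_{\tilde X}=c|_{\tilde X\times Y}$. (If $I$ is finite then $\mu(X_i)>0$ for all $i\in I$.) Degenerate plans: a transport plan $\pi\in\mathcal{C}(\mu,\nu)$ is degenerate (with respect to the decompositions into connected components) if there exist $I'\subset I$ and $J'\subset J$ with $$0<\sum_{i\in I'}\mu(X_i)=\sum_{i\in I'}\sum_{j\in J'}\pi(X_i\times Y_j)=\sum_{j\in J'}\nu(Y_j)<1;$$ otherwise it is non-degenerate. *)

theory Defs
  imports "HOL-Probability.Probability"
begin

text \<open>
  Conventions. A transport problem is given by probability measures \<^term>\<open>\<mu>\<close> and \<^term>\<open>\<nu>\<close> together with a
  cost on pairs. The underlying spaces \<open>X\<close> and \<open>Y\<close> are \<^term>\<open>space \<mu>\<close> and \<^term>\<open>space \<nu>\<close>, which may be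
  proper subsets of the ambient types; so the restricted problems are instances of the same
  definitions, and restricting the cost to \<^term>\<open>space \<mu> \<times> space \<nu>\<close> is implicit, because cost and
  potentials are only ever evaluated there. Functions with values in the reals extended by
  \<open>- \<infinity>\<close> are \<^typ>\<open>ereal\<close>-valued functions avoiding \<open>\<infinity>\<close>.
\<close>

definition msupport :: "'a::topological_space measure \<Rightarrow> 'a set" where
  "msupport M = \<Inter>{C. closed C \<and> (AE x in M. x \<in> C)}"

text \<open>On a second countable space \<^const>\<open>msupport\<close> is the smallest closed set of full measure: it is a
  lower bound of these sets by definition, and is itself one of them.\<close>

lemma closed_msupport: "closed (msupport M)"
  unfolding msupport_def by auto

lemma AE_in_msupport:
  fixes M :: "'a::second_countable_topology measure"
  shows "AE x in M. x \<in> msupport M"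
proof -
  define \<F> where "\<F> = uminus ` {C. closed C \<and> (AE x in M. x \<in> C)}"
  have op: "\<And>U. U \<in> \<F> \<Longrightarrow> open U" by (auto simp: \<F>_def)
  obtain \<G> where G: "\<G> \<subseteq> \<F>" "countable \<G>" "\<Union>\<G> = \<Union>\<F>"
    using Lindelof[OF op] by metis
  have "AE x in M. x \<notin> U" if "U \<in> \<G>" for U
    using that G(1) by (auto simp: \<F>_def)
  then have "AE x in M. \<forall>U\<in>\<G>. x \<notin> U"
    using G(2) by (simp add: AE_ball_countable)
  moreover have "x \<in> msupport M" if "\<forall>U\<in>\<G>. x \<notin> U" for x
  proof -
    have "x \<notin> \<Union>\<F>" using that G(3) by blast
    then show ?thesis by (auto simp: msupport_def \<F>_def)
  qed
  ultimately show ?thesis by auto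
qed

definition couplings :: "'a measure \<Rightarrow> 'b measure \<Rightarrow> ('a \<times> 'b) measure set" where
  "couplings \<mu> \<nu> = {\<pi>. sets \<pi> = sets (\<mu> \<Otimes>\<^sub>M \<nu>) \<and> distr \<pi> \<mu> fst = \<mu> \<and> distr \<pi> \<nu> snd = \<nu>}"

definition transport_cost :: "('a \<times> 'b \<Rightarrow> real) \<Rightarrow> 'a measure \<Rightarrow> 'b measure \<Rightarrow> ennreal" where
  "transport_cost c \<mu> \<nu> = (INF \<pi>\<in>couplings \<mu> \<nu>. \<integral>\<^sup>+ z. ennreal (c z) \<partial>\<pi>)"

definition optimal_plan ::
  "('a \<times> 'b \<Rightarrow> real) \<Rightarrow> 'a measure \<Rightarrow> 'b measure \<Rightarrow> ('a \<times> 'b) measure \<Rightarrow> bool" where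
  "optimal_plan c \<mu> \<nu> \<pi> \<longleftrightarrow>
     \<pi> \<in> couplings \<mu> \<nu> \<and> (\<integral>\<^sup>+ z. ennreal (c z) \<partial>\<pi>) = transport_cost c \<mu> \<nu>"

definition transform_X :: "'a set \<Rightarrow> ('a \<times> 'b \<Rightarrow> real) \<Rightarrow> ('a \<Rightarrow> ereal) \<Rightarrow> 'b \<Rightarrow> ereal" where
  "transform_X X c f y = (INF x\<in>X. ereal (c (x, y)) - f x)"

definition transform_Y :: "'b set \<Rightarrow> ('a \<times> 'b \<Rightarrow> real) \<Rightarrow> ('b \<Rightarrow> ereal) \<Rightarrow> 'a \<Rightarrow> ereal" where
  "transform_Y Y c g x = (INF y\<in>Y. ereal (c (x, y)) - g y)"

definition c_concave :: "'a set \<Rightarrow> 'b set \<Rightarrow> ('a \<times> 'b \<Rightarrow> real) \<Rightarrow> ('a \<Rightarrow> ereal) \<Rightarrow> bool" where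
  "c_concave X Y c f \<longleftrightarrow>
     (\<exists>g. (\<forall>y\<in>Y. g y \<noteq> \<infinity>) \<and> (\<forall>x\<in>X. f x = transform_Y Y c g x)) \<and>
     (\<forall>x\<in>X. f x \<noteq> \<infinity>) \<and> (\<exists>x\<in>X. f x \<noteq> - \<infinity>)"

text \<open>Integral of an extended real function as the difference of the integrals of its positive and
  negative parts (\<^const>\<open>e2ennreal\<close> maps negative values to zero). Below the positive part is
  dominated by the cost and hence integrable, so that \<open>\<infinity> - \<infinity>\<close> does not occur.\<close>

definition ereal_integral :: "'a measure \<Rightarrow> ('a \<Rightarrow> ereal) \<Rightarrow> ereal" where
  "ereal_integral M h =
     enn2ereal (\<integral>\<^sup>+ x. e2ennreal (h x) \<partial>M) - enn2ereal (\<integral>\<^sup>+ x. e2ennreal (- h x) \<partial>M)"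

text \<open>Values of a potential outside \<^term>\<open>space \<mu>\<close> are irrelevant and left unconstrained.\<close>

definition kantorovich_potentials ::
  "('a \<times> 'b \<Rightarrow> real) \<Rightarrow> 'a measure \<Rightarrow> 'b measure \<Rightarrow> ('a \<Rightarrow> ereal) set" where
  "kantorovich_potentials c \<mu> \<nu> =
     {f. c_concave (space \<mu>) (space \<nu>) c f \<and>
         (\<exists>\<pi>. optimal_plan c \<mu> \<nu> \<pi> \<and>
              enn2ereal (transport_cost c \<mu> \<nu>) =
                ereal_integral \<pi> (\<lambda>(x, y). f x + transform_X (space \<mu>) c f y))}"

text \<open>In \<^typ>\<open>ereal\<close> the difference \<open>- \<infinity> - (- \<infinity>)\<close> equals \<open>\<infinity>\<close>; the constant being real, both functions
  have to be finite almost surely (as potentials are when the transport cost is finite).\<close>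

definition unique_potentials ::
  "('a \<times> 'b \<Rightarrow> real) \<Rightarrow> 'a measure \<Rightarrow> 'b measure \<Rightarrow> bool" where
  "unique_potentials c \<mu> \<nu> \<longleftrightarrow>
     (\<forall>f1\<in>kantorovich_potentials c \<mu> \<nu>. \<forall>f2\<in>kantorovich_potentials c \<mu> \<nu>.
        \<exists>k::real. AE x in \<mu>. f1 x - f2 x = ereal k)"

definition restricted_source :: "'a measure \<Rightarrow> 'a set \<Rightarrow> 'a measure" where
  "restricted_source \<mu> A = scale_measure (inverse (emeasure \<mu> A)) (restrict_space \<mu> A)"

definition restricted_target ::
  "'a measure \<Rightarrow> 'b measure \<Rightarrow> ('a \<times> 'b) measure \<Rightarrow> 'a set \<Rightarrow> 'b measure" where
  "restricted_target \<mu> \<nu> \<pi> A =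
     scale_measure (inverse (emeasure \<mu> A)) (distr (restrict_space \<pi> (A \<times> space \<nu>)) \<nu> snd)"

text \<open>The families indexed by \<open>I\<close> and \<open>J\<close> are indexed by their members, so that \<open>I'\<close> and \<open>J'\<close> become
  sets of components.\<close>

definition degenerate_plan ::
  "'a::topological_space measure \<Rightarrow> 'b::topological_space measure \<Rightarrow> ('a \<times> 'b) measure \<Rightarrow> bool" where
  "degenerate_plan \<mu> \<nu> \<pi> \<longleftrightarrow>
     (\<exists>I' \<subseteq> components (msupport \<mu>). \<exists>J' \<subseteq> components (msupport \<nu>).
        0 < (\<Sum>\<^sub>\<infinity>A\<in>I'. emeasure \<mu> A) \<and>
        (\<Sum>\<^sub>\<infinity>A\<in>I'. emeasure \<mu> A) = (\<Sum>\<^sub>\<infinity>A\<in>I'. \<Sum>\<^sub>\<infinity>B\<in>J'. emeasure \<pi> (A \<times> B)) \<and>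
        (\<Sum>\<^sub>\<infinity>A\<in>I'. \<Sum>\<^sub>\<infinity>B\<in>J'. emeasure \<pi> (A \<times> B)) = (\<Sum>\<^sub>\<infinity>B\<in>J'. emeasure \<nu> B) \<and>
        (\<Sum>\<^sub>\<infinity>B\<in>J'. emeasure \<nu> B) < 1)"

definition real_continuous_on :: "'a::topological_space set \<Rightarrow> ('a \<Rightarrow> ereal) \<Rightarrow> bool" where
  "real_continuous_on S h \<longleftrightarrow> (\<exists>r::'a \<Rightarrow> real. continuous_on S r \<and> (\<forall>y\<in>S. h y = ereal (r y)))"

end

theory Submission
  imports Defs
begin

text \<open>
  Potentials \<open>f1\<close>, \<open>f2\<close> satisfy \<open>f + f\<^sup>c = c\<close> almost surely under every optimal plan \<open>\<pi>\<close>, and each is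
  also a potential of every restricted problem. Uniqueness of the latter makes \<open>f1 - f2\<close> a constant
  \<open>K A\<close> almost surely on each component \<open>A\<close> of \<open>supp \<mu>\<close>, so \<open>f1\<^sup>c - f2\<^sup>c\<close> takes almost surely only the
  finitely many values \<open>- K A\<close>. By continuity and connectedness it is then a constant \<open>H B\<close> almost
  surely on each component \<open>B\<close> of \<open>supp \<nu>\<close>. Fix \<open>A0\<close>. Up to null sets \<open>\<pi>\<close> couples exactly the
  components with \<open>K A = K A0\<close> with those with \<open>H B = - K A0\<close>; as \<open>\<pi>\<close> is non-degenerate, the former
  carry full mass.
\<close>

section \<open>Semicontinuity and measurability of c-transforms\<close>

text \<open>An infimum of continuous functions is upper semicontinuous; a point with
  \<open>f x = - \<infinity>\<close> contributes the constant \<infinity>, hence an empty set. Since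
  the infimum may run over uncountably many points, Borel measurability is obtained from these open
  sublevel sets.\<close>

lemma open_transform_X_less:
  fixes c :: "'a::topological_space \<times> 'b::topological_space \<Rightarrow> real"
  assumes c: "continuous_on UNIV c" and f: "\<And>x. x \<in> X \<Longrightarrow> f x \<noteq> \<infinity>"
  shows "open {y. transform_X X c f y < a}"
proof -
  have "open {y. ereal (c (x, y)) - f x < a}" if "x \<in> X" for x
  proof (cases "f x")
    case (real r)
    have "continuous_on UNIV (\<lambda>y. ereal (c (x, y) - r))"
      by (intro continuous_intros continuous_on_compose2[OF c]) auto
    then show ?thesis
      using real by (simp add: open_Collect_less continuous_on_const)
  qed (use f[OF that] in auto)
  moreover have "{y. transform_X X c f y < a} = (\<Union>x\<in>X. {y. ereal (c (x, y)) - f x < a})"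
    by (auto simp: transform_X_def INF_less_iff)
  ultimately show ?thesis by auto
qed

lemma borel_measurable_transform_X:
  fixes c :: "'a::topological_space \<times> 'b::topological_space \<Rightarrow> real"
  assumes "continuous_on UNIV c" and "\<And>x. x \<in> X \<Longrightarrow> f x \<noteq> \<infinity>"
  shows "transform_X X c f \<in> borel_measurable borel"
  by (rule borel_measurableI_less) (auto intro: borel_open open_transform_X_less[OF assms])

lemma borel_measurable_transform_Y:
  fixes c :: "'a::topological_space \<times> 'b::topological_space \<Rightarrow> real"
  assumes "continuous_on UNIV c" and "\<And>y. y \<in> Y \<Longrightarrow> g y \<noteq> \<infinity>"
  shows "transform_Y Y c g \<in> borel_measurable borel"
proof -
  have "transform_Y Y c g = transform_X Y (\<lambda>(y, x). c (x, y)) g"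
    by (auto simp: transform_X_def transform_Y_def)
  moreover have "continuous_on UNIV (\<lambda>(y, x). c (x, y))"
    unfolding case_prod_beta
    by (intro continuous_on_compose2[OF assms(1)] continuous_intros) auto
  ultimately show ?thesis
    using borel_measurable_transform_X assms(2) by metis
qed

lemma transform_X_neq_PInf:
  assumes "\<exists>x\<in>X. f x \<noteq> - \<infinity>"
  shows "transform_X X c f y \<noteq> \<infinity>"
proof -
  obtain x where x: "x \<in> X" "f x \<noteq> - \<infinity>" using assms by blast
  have "transform_X X c f y \<le> ereal (c (x, y)) - f x"
    unfolding transform_X_def using x by (intro INF_lower)
  with x show ?thesis by (cases "f x") auto
qed

text \<open>In \<open>ereal\<close> the sum of -\<infinity> and \<infinity> is \<infinity>, so where
  \<open>f x = - \<infinity>\<close> the bound depends on the transform avoiding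
  \<infinity>.\<close>

lemma potential_add_transform_le:
  assumes "x \<in> X" and "f x \<noteq> \<infinity>" and "transform_X X c f y \<noteq> \<infinity>"
  shows "f x + transform_X X c f y \<le> ereal (c (x, y))"
proof (cases "f x")
  case (real r)
  have "transform_X X c f y \<le> ereal (c (x, y)) - f x"
    unfolding transform_X_def using assms by (intro INF_lower)
  then show ?thesis
    by (cases "transform_X X c f y") (auto simp: real)
next
  case MInf
  with assms(3) show ?thesis by (cases "transform_X X c f y") auto
qed (use assms in auto)

section \<open>Passing between a plan and its marginals\<close>

lemma couplings_measurable:
  assumes "\<pi> \<in> couplings \<mu> \<nu>"
  shows "fst \<in> measurable \<pi> \<mu>" and "snd \<in> measurable \<pi> \<nu>"
    and "space \<pi> = space \<mu> \<times> space \<nu>"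
proof -
  have s: "sets \<pi> = sets (\<mu> \<Otimes>\<^sub>M \<nu>)" using assms by (simp add: couplings_def)
  show "fst \<in> measurable \<pi> \<mu>" "snd \<in> measurable \<pi> \<nu>"
    using measurable_cong_sets[OF s refl] by auto
  show "space \<pi> = space \<mu> \<times> space \<nu>"
    using sets_eq_imp_space_eq[OF s] by (simp add: space_pair_measure)
qed

lemma couplings_distr:
  assumes "\<pi> \<in> couplings \<mu> \<nu>"
  shows "distr \<pi> \<mu> fst = \<mu>" and "distr \<pi> \<nu> snd = \<nu>"
  using assms by (auto simp: couplings_def)

lemma couplings_AE_fst:
  assumes "\<pi> \<in> couplings \<mu> \<nu>" and "AE x in \<mu>. P x"
  shows "AE z in \<pi>. P (fst z)"
  using assms AE_distrD couplings_distr couplings_measurable by metis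

lemma couplings_AE_snd:
  assumes "\<pi> \<in> couplings \<mu> \<nu>" and "AE y in \<nu>. P y"
  shows "AE z in \<pi>. P (snd z)"
  using assms AE_distrD couplings_distr couplings_measurable by metis

lemma couplings_AE_fst_iff:
  assumes "\<pi> \<in> couplings \<mu> \<nu>" and "{x \<in> space \<mu>. P x} \<in> sets \<mu>"
  shows "(AE z in \<pi>. P (fst z)) \<longleftrightarrow> (AE x in \<mu>. P x)"
  using AE_distr_iff[of fst \<pi> \<mu> P] couplings_distr couplings_measurable assms by metis

lemma couplings_AE_snd_iff:
  assumes "\<pi> \<in> couplings \<mu> \<nu>" and "{y \<in> space \<nu>. P y} \<in> sets \<nu>"
  shows "(AE z in \<pi>. P (snd z)) \<longleftrightarrow> (AE y in \<nu>. P y)"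
  using AE_distr_iff[of snd \<pi> \<nu> P] couplings_distr couplings_measurable assms by metis

lemma couplings_nn_integral_fst:
  assumes "\<pi> \<in> couplings \<mu> \<nu>" and "h \<in> borel_measurable \<mu>"
  shows "(\<integral>\<^sup>+ z. h (fst z) \<partial>\<pi>) = (\<integral>\<^sup>+ x. h x \<partial>\<mu>)"
  using nn_integral_distr[of fst \<pi> \<mu> h] couplings_distr couplings_measurable assms by metis

lemma couplings_nn_integral_snd:
  assumes "\<pi> \<in> couplings \<mu> \<nu>" and "h \<in> borel_measurable \<nu>"
  shows "(\<integral>\<^sup>+ z. h (snd z) \<partial>\<pi>) = (\<integral>\<^sup>+ y. h y \<partial>\<nu>)"
  using nn_integral_distr[of snd \<pi> \<nu> h] couplings_distr couplings_measurable assms by metis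

section \<open>The integral of u(x) + v(y) depends only on the marginals\<close>

text \<open>Clamping each summand separately, rather than the sum, keeps the form u(x) + v(y), whose
  integral the marginals determine, and makes both summands integrable against finite
  marginals.\<close>

definition clamp_real :: "nat \<Rightarrow> real \<Rightarrow> real" where
  "clamp_real n a = max (- real n) (min (real n) a)"

lemma clamp_real_measurable [measurable]: "clamp_real n \<in> borel_measurable borel"
  unfolding clamp_real_def by measurable

lemma clamp_real_eventually: "eventually (\<lambda>n. clamp_real n a = a) sequentially"
proof -
  obtain N where "\<bar>a\<bar> \<le> real N" using real_arch_simple by blast
  then show ?thesis
    unfolding eventually_sequentially clamp_real_def by (intro exI[of _ N]) auto
qed

lemma clamp_real_uminus: "clamp_real n (- a) = - clamp_real n a"
  by (auto simp: clamp_real_def)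

text \<open>The signed sum need not be monotone in the cut-off, but once positive it only grows: a
  negative summand is then smaller in modulus than the other one, so it lies within the cut-off and
  no longer changes. This provides the monotone convergence below.\<close>

lemma ennreal_clamp_real_add_mono:
  assumes "n \<le> m"
  shows "ennreal (clamp_real n a + clamp_real n b) \<le> ennreal (clamp_real m a + clamp_real m b)"
proof (cases "clamp_real n a + clamp_real n b \<le> 0")
  case False
  then have "clamp_real n a + clamp_real n b \<le> clamp_real m a + clamp_real m b"
    using assms unfolding clamp_real_def min_def max_def by (auto split: if_splits)
  then show ?thesis by (rule ennreal_leI)
qed (simp add: ennreal_neg)

lemma nn_integral_clamp_LIMSEQ:
  assumes [measurable]: "u \<in> borel_measurable M" "v \<in> borel_measurable M"
  shows "(\<lambda>n. \<integral>\<^sup>+ z. ennreal (clamp_real n (u z) + clamp_real n (v z)) \<partial>M)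
           \<longlonglongrightarrow> (\<integral>\<^sup>+ z. ennreal (u z + v z) \<partial>M)"
proof (rule nn_integral_LIMSEQ)
  show "incseq (\<lambda>n z. ennreal (clamp_real n (u z) + clamp_real n (v z)))"
    by (auto simp: incseq_def le_fun_def intro: ennreal_clamp_real_add_mono)
  show "(\<lambda>n. ennreal (clamp_real n (u z) + clamp_real n (v z))) \<longlonglongrightarrow> ennreal (u z + v z)" for z
    by (rule tendsto_eventually, rule eventually_mono[OF eventually_conj[OF
          clamp_real_eventually[of "u z"] clamp_real_eventually[of "v z"]]]) auto
qed measurable

text \<open>For s = a + b the identity s^+ + a^- + b^- = s^- + a^+ + b^+ avoids subtraction in
  \<open>ennreal\<close>. After integration, the parts of u and v become integrals over the
  marginals, the same for every plan.\<close>

lemma nn_integral_bounded_marginals: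
  fixes u :: "'a \<Rightarrow> real" and v :: "'b \<Rightarrow> real"
  assumes \<pi>: "\<pi> \<in> couplings \<mu> \<nu>"
    and [measurable]: "u \<in> borel_measurable \<mu>" "v \<in> borel_measurable \<nu>"
  shows "(\<integral>\<^sup>+ z. ennreal (u (fst z) + v (snd z)) \<partial>\<pi>)
           + ((\<integral>\<^sup>+ x. ennreal (- u x) \<partial>\<mu>) + (\<integral>\<^sup>+ y. ennreal (- v y) \<partial>\<nu>))
       = (\<integral>\<^sup>+ z. ennreal (- u (fst z) - v (snd z)) \<partial>\<pi>)
           + ((\<integral>\<^sup>+ x. ennreal (u x) \<partial>\<mu>) + (\<integral>\<^sup>+ y. ennreal (v y) \<partial>\<nu>))"
proof -
  note [measurable] = couplings_measurable(1,2)[OF \<pi>]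
  have pt: "ennreal (a + b) + (ennreal (- a) + ennreal (- b))
      = ennreal (- a - b) + (ennreal a + ennreal b)" for a b :: real
  proof -
    \<comment> \<open>\<open>ennreal\<close> cuts negative numbers off at 0, so its additivity is
      available for nonnegative arguments; all six terms are first rewritten to that form.\<close>
    have e: "ennreal t = ennreal (max 0 t)" for t by simp
    have "max 0 (a + b) + (max 0 (- a) + max 0 (- b)) = max 0 (- a - b) + (max 0 a + max 0 b)"
      by (auto simp: max_def)
    then show ?thesis
      by (subst (1 2 3 4 5 6) e) (simp del: ennreal_max_0 ennreal_max_0' flip: ennreal_plus)
  qed
  have "(\<integral>\<^sup>+ z. ennreal (u (fst z) + v (snd z)) \<partial>\<pi>)
           + ((\<integral>\<^sup>+ x. ennreal (- u x) \<partial>\<mu>) + (\<integral>\<^sup>+ y. ennreal (- v y) \<partial>\<nu>))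
      = (\<integral>\<^sup>+ z. ennreal (u (fst z) + v (snd z)) + (ennreal (- u (fst z)) + ennreal (- v (snd z))) \<partial>\<pi>)"
    by (simp add: nn_integral_add couplings_nn_integral_fst[OF \<pi>, of "\<lambda>x. ennreal (- u x)"]
        couplings_nn_integral_snd[OF \<pi>, of "\<lambda>y. ennreal (- v y)"])
  also have "\<dots> = (\<integral>\<^sup>+ z. ennreal (- u (fst z) - v (snd z)) + (ennreal (u (fst z)) + ennreal (v (snd z))) \<partial>\<pi>)"
    by (simp only: pt)
  also have "\<dots> = (\<integral>\<^sup>+ z. ennreal (- u (fst z) - v (snd z)) \<partial>\<pi>)
           + ((\<integral>\<^sup>+ x. ennreal (u x) \<partial>\<mu>) + (\<integral>\<^sup>+ y. ennreal (v y) \<partial>\<nu>))"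
    by (simp add: nn_integral_add couplings_nn_integral_fst[OF \<pi>, of "\<lambda>x. ennreal (u x)"]
        couplings_nn_integral_snd[OF \<pi>, of "\<lambda>y. ennreal (v y)"])
  finally show ?thesis .
qed

lemma (in finite_measure) nn_integral_bounded_finite:
  assumes "\<And>x. h x \<le> K"
  shows "(\<integral>\<^sup>+ x. ennreal (h x) \<partial>M) < \<infinity>"
proof -
  have "(\<integral>\<^sup>+ x. ennreal (h x) \<partial>M) \<le> (\<integral>\<^sup>+ x. ennreal K \<partial>M)"
    by (intro nn_integral_mono ennreal_leI assms)
  also have "\<dots> < \<infinity>"
    using emeasure_finite[of "space M"] by (simp add: ennreal_mult_eq_top_iff less_top[symmetric])
  finally show ?thesis .
qed

text \<open>\<open>u\<close> and \<open>v\<close> need not be integrable, so the difference of the positive and negative parts is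
  compared between plans by truncation; it is stated with sums because the parts may be infinite.\<close>

lemma nn_integral_marginals_indep:
  fixes u :: "'a \<Rightarrow> real" and v :: "'b \<Rightarrow> real"
  assumes fin: "finite_measure \<mu>" "finite_measure \<nu>"
    and \<pi>: "\<pi> \<in> couplings \<mu> \<nu>" and \<rho>: "\<rho> \<in> couplings \<mu> \<nu>"
    and [measurable]: "u \<in> borel_measurable \<mu>" "v \<in> borel_measurable \<nu>"
  shows "(\<integral>\<^sup>+ z. ennreal (u (fst z) + v (snd z)) \<partial>\<pi>) + (\<integral>\<^sup>+ z. ennreal (- u (fst z) - v (snd z)) \<partial>\<rho>)
       = (\<integral>\<^sup>+ z. ennreal (u (fst z) + v (snd z)) \<partial>\<rho>) + (\<integral>\<^sup>+ z. ennreal (- u (fst z) - v (snd z)) \<partial>\<pi>)"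
proof -
  note [measurable] = couplings_measurable(1,2)[OF \<pi>] couplings_measurable(1,2)[OF \<rho>]
  define P where "P M n = (\<integral>\<^sup>+ z. ennreal (clamp_real n (u (fst z)) + clamp_real n (v (snd z))) \<partial>M)"
    for M :: "('a \<times> 'b) measure" and n
  define N where "N M n = (\<integral>\<^sup>+ z. ennreal (- clamp_real n (u (fst z)) - clamp_real n (v (snd z))) \<partial>M)"
    for M :: "('a \<times> 'b) measure" and n
  have limP: "P M \<longlonglongrightarrow> (\<integral>\<^sup>+ z. ennreal (u (fst z) + v (snd z)) \<partial>M)" if "M \<in> {\<pi>, \<rho>}" for M
    unfolding P_def using that by (intro nn_integral_clamp_LIMSEQ) auto
  have limN: "N M \<longlonglongrightarrow> (\<integral>\<^sup>+ z. ennreal (- u (fst z) - v (snd z)) \<partial>M)" if "M \<in> {\<pi>, \<rho>}" for M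
  proof -
    have "(\<lambda>z. - u (fst z)) \<in> borel_measurable M" "(\<lambda>z. - v (snd z)) \<in> borel_measurable M"
      using that by auto
    from nn_integral_clamp_LIMSEQ[OF this] show ?thesis
      unfolding N_def by (simp add: clamp_real_uminus)
  qed
  have eq: "P \<pi> n + N \<rho> n = P \<rho> n + N \<pi> n" for n
  proof -
    \<comment> \<open>These marginal terms are shared by \<pi> and \<rho>, and truncation makes them
      finite. Hence they cancel after the two balance equations are added crosswise.\<close>
    define a b where "a = (\<integral>\<^sup>+ x. ennreal (- clamp_real n (u x)) \<partial>\<mu>) + (\<integral>\<^sup>+ y. ennreal (- clamp_real n (v y)) \<partial>\<nu>)"
      and "b = (\<integral>\<^sup>+ x. ennreal (clamp_real n (u x)) \<partial>\<mu>) + (\<integral>\<^sup>+ y. ennreal (clamp_real n (v y)) \<partial>\<nu>)"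
    have "clamp_real n t \<le> real n" "- clamp_real n t \<le> real n" for t
      by (auto simp: clamp_real_def)
    note bounded = finite_measure.nn_integral_bounded_finite[where K = "real n", OF _ this(1)]
      finite_measure.nn_integral_bounded_finite[where K = "real n", OF _ this(2)]
    have "a + b < \<infinity>"
      unfolding a_def b_def using fin by (simp add: bounded[unfolded infinity_ennreal_def])
    moreover have "P \<pi> n + a = N \<pi> n + b" "P \<rho> n + a = N \<rho> n + b"
      unfolding P_def N_def a_def b_def
      by (intro nn_integral_bounded_marginals[OF \<pi>] nn_integral_bounded_marginals[OF \<rho>]; measurable)+
    then have "(a + b) + (P \<pi> n + N \<rho> n) = (a + b) + (P \<rho> n + N \<pi> n)"
      by (metis (no_types, lifting) add.assoc add.commute)
    ultimately show ?thesis
      by (auto simp: ennreal_add_left_cancel)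
  qed
  have "(\<lambda>n. P \<pi> n + N \<rho> n) \<longlonglongrightarrow> (\<integral>\<^sup>+ z. ennreal (u (fst z) + v (snd z)) \<partial>\<pi>) + (\<integral>\<^sup>+ z. ennreal (- u (fst z) - v (snd z)) \<partial>\<rho>)"
    by (intro tendsto_add limP limN) auto
  moreover have "(\<lambda>n. P \<rho> n + N \<pi> n) \<longlonglongrightarrow> (\<integral>\<^sup>+ z. ennreal (u (fst z) + v (snd z)) \<partial>\<rho>) + (\<integral>\<^sup>+ z. ennreal (- u (fst z) - v (snd z)) \<partial>\<pi>)"
    by (intro tendsto_add limP limN) auto
  ultimately show ?thesis
    unfolding eq by (rule LIMSEQ_unique)
qed


section \<open>Optimality of a plan and contact with a dual pair\<close>

lemma AE_eq_if_nn_integral_eq: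
  assumes [measurable]: "a \<in> borel_measurable M" "b \<in> borel_measurable M"
    and le: "AE x in M. a x \<le> b x" and eq: "integral\<^sup>N M a = integral\<^sup>N M b" and fin: "integral\<^sup>N M b < \<infinity>"
  shows "AE x in M. a x = b x"
proof -
  have "(\<integral>\<^sup>+ x. b x - a x \<partial>M) = integral\<^sup>N M b - integral\<^sup>N M a"
    using le fin eq by (intro nn_integral_diff) auto
  then have "(\<integral>\<^sup>+ x. b x - a x \<partial>M) = 0"
    using eq fin by (simp add: less_top[symmetric])
  then have "AE x in M. b x - a x = 0"
    by (subst (asm) nn_integral_0_iff_AE) auto
  with le show ?thesis
    by eventually_elim (auto simp: ennreal_minus_eq_0 antisym)
qed

text \<open>Complementary slackness. Under \<pi> the sum f + g equals c \<ge> 0, so its negative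
  part vanishes there. As the positive minus the negative part is independent of the plan, the cost
  of \<pi> plus the negative part under \<rho> is the positive part under \<rho>, which is at most
  the cost of \<rho>. If both costs agree and are finite, that negative part is 0 and the last bound
  is an equality.\<close>

lemma
  assumes fin: "finite_measure \<mu>" "finite_measure \<nu>"
    and \<pi>: "\<pi> \<in> couplings \<mu> \<nu>" and \<rho>: "\<rho> \<in> couplings \<mu> \<nu>"
    and [measurable]: "f \<in> borel_measurable \<mu>" "g \<in> borel_measurable \<nu>"
    and le: "\<And>x y. x \<in> space \<mu> \<Longrightarrow> y \<in> space \<nu> \<Longrightarrow> f x + g y \<le> ereal (c (x, y))"
    and c: "\<And>z. 0 \<le> c z"
    and contact: "AE z in \<pi>. f (fst z) + g (snd z) = ereal (c z)"
  shows nn_integral_contact_plan_le: "(\<integral>\<^sup>+ z. ennreal (c z) \<partial>\<pi>) \<le> (\<integral>\<^sup>+ z. ennreal (c z) \<partial>\<rho>)"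
    and AE_contact_if_nn_integral_eq:
      "\<lbrakk>(\<integral>\<^sup>+ z. ennreal (c z) \<partial>\<rho>) = (\<integral>\<^sup>+ z. ennreal (c z) \<partial>\<pi>); (\<integral>\<^sup>+ z. ennreal (c z) \<partial>\<pi>) < \<infinity>;
        c \<in> borel_measurable \<rho>\<rbrakk> \<Longrightarrow> AE z in \<rho>. f (fst z) + g (snd z) = ereal (c z)"
proof -
  note [measurable] = couplings_measurable(1,2)[OF \<pi>] couplings_measurable(1,2)[OF \<rho>]
  \<comment> \<open>\<open>real_of_ereal\<close> sends both infinities to 0. This is harmless:
    contact forces f and g to be finite almost surely under \<pi>, hence under the marginals, hence
    under every coupling.\<close>
  define u v where "u x = real_of_ereal (f x)" and "v y = real_of_ereal (g y)" for x y
  have [measurable]: "u \<in> borel_measurable \<mu>" "v \<in> borel_measurable \<nu>"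
    unfolding u_def v_def by measurable
  have fg: "\<bar>a\<bar> \<noteq> \<infinity> \<and> \<bar>b\<bar> \<noteq> \<infinity>" if "a + b = ereal r" for a b r
    using that by (cases a; cases b) auto
  have "AE z in \<pi>. \<bar>f (fst z)\<bar> \<noteq> \<infinity>"
    using contact by eventually_elim (metis fg)
  then have f\<mu>: "AE x in \<mu>. \<bar>f x\<bar> \<noteq> \<infinity>"
    by (subst (asm) couplings_AE_fst_iff[OF \<pi>]) measurable
  have "AE z in \<pi>. \<bar>g (snd z)\<bar> \<noteq> \<infinity>"
    using contact by eventually_elim (metis fg)
  then have g\<nu>: "AE y in \<nu>. \<bar>g y\<bar> \<noteq> \<infinity>"
    by (subst (asm) couplings_AE_snd_iff[OF \<pi>]) measurable
  have uv: "AE z in M. f (fst z) + g (snd z) = ereal (u (fst z) + v (snd z))"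
    if "M \<in> couplings \<mu> \<nu>" for M
    using couplings_AE_fst[OF that f\<mu>] couplings_AE_snd[OF that g\<nu>]
  proof eventually_elim
    case (elim z)
    then show ?case
      by (cases "f (fst z)"; cases "g (snd z)") (auto simp: u_def v_def)
  qed
  have uv_le: "AE z in \<rho>. u (fst z) + v (snd z) \<le> c z"
    using uv[OF \<rho>] AE_space
  proof eventually_elim
    case (elim z)
    then show ?case
      using le[of "fst z" "snd z"] by (auto simp: couplings_measurable(3)[OF \<rho>])
  qed
  have uv_eq: "AE z in \<pi>. u (fst z) + v (snd z) = c z"
    using uv[OF \<pi>] contact by eventually_elim auto
  have "(\<integral>\<^sup>+ z. ennreal (u (fst z) + v (snd z)) \<partial>\<pi>) = (\<integral>\<^sup>+ z. ennreal (c z) \<partial>\<pi>)"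
    using uv_eq by (intro nn_integral_cong_AE) auto
  moreover have "(\<integral>\<^sup>+ z. ennreal (- u (fst z) - v (snd z)) \<partial>\<pi>) = (\<integral>\<^sup>+ z. 0 \<partial>\<pi>)"
    using uv_eq
  proof (intro nn_integral_cong_AE, eventually_elim)
    case (elim z)
    then show ?case using c[of z] by (auto simp: ennreal_neg)
  qed
  ultimately have eq: "(\<integral>\<^sup>+ z. ennreal (c z) \<partial>\<pi>) + (\<integral>\<^sup>+ z. ennreal (- u (fst z) - v (snd z)) \<partial>\<rho>)
      = (\<integral>\<^sup>+ z. ennreal (u (fst z) + v (snd z)) \<partial>\<rho>)"
    using nn_integral_marginals_indep[OF fin \<pi> \<rho>, of u v] by simp
  have P_le: "(\<integral>\<^sup>+ z. ennreal (u (fst z) + v (snd z)) \<partial>\<rho>) \<le> (\<integral>\<^sup>+ z. ennreal (c z) \<partial>\<rho>)"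
    using uv_le by (intro nn_integral_mono_AE) (auto intro: ennreal_leI)
  have C_le: "(\<integral>\<^sup>+ z. ennreal (c z) \<partial>\<pi>) \<le> (\<integral>\<^sup>+ z. ennreal (u (fst z) + v (snd z)) \<partial>\<rho>)"
    by (simp flip: eq)
  show "(\<integral>\<^sup>+ z. ennreal (c z) \<partial>\<pi>) \<le> (\<integral>\<^sup>+ z. ennreal (c z) \<partial>\<rho>)"
    using C_le P_le by (rule order_trans)
  show "AE z in \<rho>. f (fst z) + g (snd z) = ereal (c z)"
    if C: "(\<integral>\<^sup>+ z. ennreal (c z) \<partial>\<rho>) = (\<integral>\<^sup>+ z. ennreal (c z) \<partial>\<pi>)" "(\<integral>\<^sup>+ z. ennreal (c z) \<partial>\<pi>) < \<infinity>"
      and [measurable]: "c \<in> borel_measurable \<rho>"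
  proof -
    have P: "(\<integral>\<^sup>+ z. ennreal (u (fst z) + v (snd z)) \<partial>\<rho>) = (\<integral>\<^sup>+ z. ennreal (c z) \<partial>\<rho>)"
      using P_le C_le C(1) by simp
    then have "(\<integral>\<^sup>+ z. ennreal (c z) \<partial>\<pi>) + (\<integral>\<^sup>+ z. ennreal (- u (fst z) - v (snd z)) \<partial>\<rho>)
        = (\<integral>\<^sup>+ z. ennreal (c z) \<partial>\<pi>) + 0"
      using eq C by simp
    then have "(\<integral>\<^sup>+ z. ennreal (- u (fst z) - v (snd z)) \<partial>\<rho>) = 0"
      using C(2) by (subst (asm) ennreal_add_left_cancel) auto
    then have N: "AE z in \<rho>. ennreal (- u (fst z) - v (snd z)) = 0"
      by (subst (asm) nn_integral_0_iff_AE) auto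
    have "AE z in \<rho>. ennreal (u (fst z) + v (snd z)) = ennreal (c z)"
      using P C uv_le by (intro AE_eq_if_nn_integral_eq) (auto intro: ennreal_leI)
    \<comment> \<open>Where c vanishes, equality under \<open>ennreal\<close> yields only u + v
      \<le> 0; \<open>N\<close> supplies the reverse inequality.\<close>
    with N uv[OF \<rho>] show ?thesis
    proof eventually_elim
      case (elim z)
      then show ?case using c[of z] by (auto simp: ennreal_eq_0_iff)
    qed
  qed
qed

text \<open>Let P and N be the integrals of the positive and negative parts of h. P is at most the
  finite integral of c, and that integral equals P - N, which forces N = 0 and P to equal
  it.\<close>

lemma AE_eq_if_ereal_integral_eq:
  assumes [measurable]: "h \<in> borel_measurable M" "c \<in> borel_measurable M"
    and le: "AE z in M. h z \<le> ereal (c z)" and c: "\<And>z. 0 \<le> c z"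
    and fin: "(\<integral>\<^sup>+ z. ennreal (c z) \<partial>M) < \<infinity>"
    and eq: "enn2ereal (\<integral>\<^sup>+ z. ennreal (c z) \<partial>M) = ereal_integral M h"
  shows "AE z in M. h z = ereal (c z)"
proof -
  define P N where "P = (\<integral>\<^sup>+ z. e2ennreal (h z) \<partial>M)" and "N = (\<integral>\<^sup>+ z. e2ennreal (- h z) \<partial>M)"
  have e2: "e2ennreal t \<le> ennreal r" if "t \<le> ereal r" for t r
    using e2ennreal_mono[OF that] by simp
  have P_le: "P \<le> (\<integral>\<^sup>+ z. ennreal (c z) \<partial>M)"
    unfolding P_def using le by (intro nn_integral_mono_AE) (auto intro: e2)
  have PN: "P = (\<integral>\<^sup>+ z. ennreal (c z) \<partial>M) \<and> N = 0"
    using eq fin P_le unfolding ereal_integral_def P_def[symmetric] N_def[symmetric]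
    by (cases P; cases N; cases "\<integral>\<^sup>+ z. ennreal (c z) \<partial>M")
       (auto simp: enn2ereal_ennreal top_ennreal.rep_eq simp flip: ennreal_0)
  have N: "AE z in M. e2ennreal (- h z) = 0"
    using PN unfolding N_def by (subst (asm) nn_integral_0_iff_AE) auto
  have "AE z in M. e2ennreal (h z) = ennreal (c z)"
    using PN fin le unfolding P_def by (intro AE_eq_if_nn_integral_eq) (auto intro: e2)
  with N show ?thesis
  proof eventually_elim
    case (elim z)
    then show ?case
      using c[of z] by (cases "h z") (auto simp: ennreal_eq_0_iff)
  qed
qed

text \<open>The definition of a potential supplies only some optimal plan \<rho>. Contact holds
  under \<rho> because the dual integral attains the cost, and complementary slackness carries it
  over to the given optimal plan \<pi>.\<close>

lemma kantorovich_potential_contact: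
  fixes \<mu> :: "'a::second_countable_topology measure" and \<nu> :: "'b::second_countable_topology measure"
  assumes fin: "finite_measure \<mu>" "finite_measure \<nu>"
    and \<mu>: "sets \<mu> = sets borel" and \<nu>: "sets \<nu> = sets borel"
    and cont: "continuous_on UNIV c" and c: "\<And>z. 0 \<le> c z"
    and T: "transport_cost c \<mu> \<nu> < \<infinity>"
    and f: "f \<in> kantorovich_potentials c \<mu> \<nu>" and \<pi>: "optimal_plan c \<mu> \<nu> \<pi>"
  shows "AE z in \<pi>. f (fst z) + transform_X UNIV c f (snd z) = ereal (c z)"
proof -
  have sp: "space \<mu> = UNIV" "space \<nu> = UNIV"
    using sets_eq_imp_space_eq[OF \<mu>] sets_eq_imp_space_eq[OF \<nu>] by auto
  let ?g = "transform_X UNIV c f"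
  have "c_concave UNIV UNIV c f"
    using f by (simp add: kantorovich_potentials_def sp)
  then obtain h where h: "\<And>y. h y \<noteq> \<infinity>" "\<And>x. f x = transform_Y UNIV c h x"
    and f_neq: "\<And>x. f x \<noteq> \<infinity>" "\<exists>x. f x \<noteq> - \<infinity>"
    unfolding c_concave_def by blast
  obtain \<rho> where \<rho>: "optimal_plan c \<mu> \<nu> \<rho>"
    and eq: "enn2ereal (transport_cost c \<mu> \<nu>) = ereal_integral \<rho> (\<lambda>z. f (fst z) + ?g (snd z))"
    using f unfolding kantorovich_potentials_def sp case_prod_beta' by blast
  have f_meas [measurable]: "f \<in> borel_measurable \<mu>"
    unfolding measurable_cong_sets[OF \<mu> refl] using borel_measurable_transform_Y[OF cont, of UNIV h] h(1)
    by (simp add: ext[of f, OF h(2)])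
  have g_meas [measurable]: "?g \<in> borel_measurable \<nu>"
    unfolding measurable_cong_sets[OF \<nu> refl] using borel_measurable_transform_X[OF cont, of UNIV f] f_neq by auto
  have le: "f x + ?g y \<le> ereal (c (x, y))" for x y
    using f_neq by (intro potential_add_transform_le transform_X_neq_PInf) auto
  have c_meas: "c \<in> borel_measurable M" if "M \<in> couplings \<mu> \<nu>" for M
  proof -
    have "sets M = sets (borel \<Otimes>\<^sub>M borel)"
      using that sets_pair_measure_cong[OF \<mu> \<nu>] by (simp add: couplings_def)
    \<comment> \<open>By second countability the product of the Borel sigma-algebras is the Borel
      sigma-algebra of the product, so the continuous cost is measurable for the plan.\<close>
    then have "sets M = sets borel"
      by (simp only: borel_prod)
    then show ?thesis
      using borel_measurable_continuous_onI[OF cont] measurable_cong_sets by blast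
  qed
  have \<pi>': "\<pi> \<in> couplings \<mu> \<nu>" "(\<integral>\<^sup>+ z. ennreal (c z) \<partial>\<pi>) = transport_cost c \<mu> \<nu>"
    and \<rho>': "\<rho> \<in> couplings \<mu> \<nu>" "(\<integral>\<^sup>+ z. ennreal (c z) \<partial>\<rho>) = transport_cost c \<mu> \<nu>"
    using \<pi> \<rho> by (auto simp: optimal_plan_def)
  note [measurable] = couplings_measurable(1,2)[OF \<rho>'(1)] c_meas[OF \<rho>'(1)]
  have "AE z in \<rho>. f (fst z) + ?g (snd z) = ereal (c z)"
    using le c T eq \<rho>'(2) by (intro AE_eq_if_ereal_integral_eq) auto
  from AE_contact_if_nn_integral_eq[OF fin \<rho>'(1) \<pi>'(1) f_meas g_meas le c this]
  show ?thesis
    using T \<pi>' \<rho>'(2) c_meas by simp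
qed

section \<open>Restricted problems\<close>

text \<open>Both sigma-algebras live on the same set, and measurability of the identity in both
  directions gives the two inclusions. This matches the restricted plan with the product
  sigma-algebra that \<open>couplings\<close> demands.\<close>

lemma sets_restrict_space_Times:
  assumes "A \<in> sets M"
  shows "sets (restrict_space (M \<Otimes>\<^sub>M N) (A \<times> space N)) = sets (restrict_space M A \<Otimes>\<^sub>M N)"
    (is "sets ?L = sets ?R")
proof -
  have sp: "space ?L = A \<times> space N" "space ?R = A \<times> space N"
    using sets.sets_into_space[OF assms] by (auto simp: space_restrict_space space_pair_measure)
  have "id \<in> measurable ?L ?R"
  proof (rule measurable_pair)
    show "fst \<circ> id \<in> measurable ?L (restrict_space M A)"
      by (auto intro!: measurable_restrict_space3)
    show "snd \<circ> id \<in> measurable ?L N"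
      by (auto intro!: measurable_restrict_space1)
  qed
  moreover have "id \<in> measurable ?R ?L"
  proof (rule measurable_restrict_space2)
    show "id \<in> measurable ?R (M \<Otimes>\<^sub>M N)"
    proof (rule measurable_pair)
      have "(\<lambda>x. x) \<in> measurable (restrict_space M A) M"
        by (auto intro!: measurable_restrict_space1)
      from measurable_compose[OF measurable_fst this] show "fst \<circ> id \<in> measurable ?R M"
        by (simp add: comp_def)
    qed simp
  qed (auto simp: sp)
  moreover have "sets N' \<subseteq> sets M'"
    if "id \<in> measurable M' N'" "space N' = space M'" for M' N' :: "('a \<times> 'b) measure"
  proof
    fix X assume X: "X \<in> sets N'"
    then have "id -` X \<inter> space M' = X"
      using sets.sets_into_space[OF X] that(2) by auto
    with measurable_sets[OF that(1) X] show "X \<in> sets M'" by simp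
  qed
  ultimately show ?thesis
    unfolding set_eq_subset using sp by simp
qed

lemma AE_scale_measure:
  assumes "AE x in M. P x"
  shows "AE x in scale_measure r M. P x"
proof -
  have "null_sets M \<subseteq> null_sets (scale_measure r M)"
    by (auto simp: null_sets_def)
  with assms show ?thesis
    by (auto simp: eventually_ae_filter space_scale_measure)
qed

text \<open>For a coupling \<pi> this is \<pi> conditioned on the first coordinate lying in A, the
  candidate optimal plan of the restricted problem.\<close>

definition restricted_plan ::
  "'a measure \<Rightarrow> 'b measure \<Rightarrow> ('a \<times> 'b) measure \<Rightarrow> 'a set \<Rightarrow> ('a \<times> 'b) measure" where
  "restricted_plan \<mu> \<nu> \<pi> A =
     scale_measure (inverse (emeasure \<mu> A)) (restrict_space \<pi> (A \<times> space \<nu>))"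

text \<open>The second marginal is correct by the definition of \<open>restricted_target\<close>.
  For the first, a set inside A has the same preimage under \<open>fst\<close> in the restricted and
  in the full product.\<close>

lemma restricted_plan_coupling:
  assumes \<pi>: "\<pi> \<in> couplings \<mu> \<nu>" and A: "A \<in> sets \<mu>"
  shows "restricted_plan \<mu> \<nu> \<pi> A
           \<in> couplings (restricted_source \<mu> A) (restricted_target \<mu> \<nu> \<pi> A)"
proof -
  let ?\<pi> = "restrict_space \<pi> (A \<times> space \<nu>)"
  have s: "sets \<pi> = sets (\<mu> \<Otimes>\<^sub>M \<nu>)" using \<pi> by (simp add: couplings_def)
  have A_sub: "A \<subseteq> space \<mu>" using sets.sets_into_space[OF A] .
  have A': "A \<times> space \<nu> \<in> sets \<pi>" using A s by auto
  then have A'': "A \<times> space \<nu> \<inter> space \<pi> \<in> sets \<pi>" by simp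
  have sp: "space \<pi> = space \<mu> \<times> space \<nu>" by (rule couplings_measurable[OF \<pi>])
  have sp': "space ?\<pi> = A \<times> space \<nu>" using A_sub by (auto simp: space_restrict_space sp)
  have fst': "fst \<in> measurable ?\<pi> (restrict_space \<mu> A)"
    using couplings_measurable[OF \<pi>] by (intro measurable_restrict_space3) auto
  have snd': "snd \<in> measurable ?\<pi> \<nu>"
    using couplings_measurable[OF \<pi>] by (intro measurable_restrict_space1)
  have "sets ?\<pi> = sets (restrict_space \<mu> A \<Otimes>\<^sub>M \<nu>)"
    using sets_restrict_space_cong[OF s] sets_restrict_space_Times[OF A] by simp
  then have "sets (restricted_plan \<mu> \<nu> \<pi> A)
      = sets (restricted_source \<mu> A \<Otimes>\<^sub>M restricted_target \<mu> \<nu> \<pi> A)"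
    unfolding restricted_plan_def restricted_source_def restricted_target_def
    by (simp cong: sets_pair_measure_cong)
  moreover have "distr (restricted_plan \<mu> \<nu> \<pi> A) (restricted_source \<mu> A) fst = restricted_source \<mu> A"
  proof (rule measure_eqI)
    fix B assume "B \<in> sets (distr (restricted_plan \<mu> \<nu> \<pi> A) (restricted_source \<mu> A) fst)"
    then have B: "B \<in> sets (restrict_space \<mu> A)" by (simp add: restricted_source_def)
    then have B': "B \<subseteq> A" "B \<in> sets \<mu>"
      using A A_sub by (auto simp: sets_restrict_space_iff)
    have "emeasure ?\<pi> (fst -` B \<inter> space ?\<pi>) = emeasure \<pi> (fst -` B \<inter> space \<pi>)"
      using B' A_sub A'' by (subst emeasure_restrict_space)
        (auto simp: sp sp' sets.Int_space_eq2 intro!: arg_cong[where f = "emeasure \<pi>"])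
    also have "\<dots> = emeasure \<mu> B"
      using emeasure_distr[OF couplings_measurable(1)[OF \<pi>] B'(2)] couplings_distr[OF \<pi>] by simp
    also have "\<dots> = emeasure (restrict_space \<mu> A) B"
      using B' A A_sub by (subst emeasure_restrict_space) auto
    finally show "emeasure (distr (restricted_plan \<mu> \<nu> \<pi> A) (restricted_source \<mu> A) fst) B
        = emeasure (restricted_source \<mu> A) B"
      using B fst' unfolding restricted_plan_def restricted_source_def
      by (subst emeasure_distr) (auto simp: space_scale_measure cong: measurable_cong_sets)
  qed simp
  moreover have "distr (restricted_plan \<mu> \<nu> \<pi> A) (restricted_target \<mu> \<nu> \<pi> A) snd
      = restricted_target \<mu> \<nu> \<pi> A"
  proof (rule measure_eqI)
    fix B assume "B \<in> sets (distr (restricted_plan \<mu> \<nu> \<pi> A) (restricted_target \<mu> \<nu> \<pi> A) snd)"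
    then have B: "B \<in> sets \<nu>" by (simp add: restricted_target_def)
    then show "emeasure (distr (restricted_plan \<mu> \<nu> \<pi> A) (restricted_target \<mu> \<nu> \<pi> A) snd) B
        = emeasure (restricted_target \<mu> \<nu> \<pi> A) B"
      using snd' unfolding restricted_plan_def restricted_target_def
      by (subst emeasure_distr)
        (auto simp: space_scale_measure emeasure_distr cong: measurable_cong_sets)
  qed simp
  ultimately show ?thesis by (simp add: couplings_def)
qed

text \<open>Converse of \<open>kantorovich_potential_contact\<close>, used to recognise potentials
  of restricted problems. On contact points the sum equals c \<ge> 0, so the negative part in
  \<open>ereal_integral\<close> is 0.\<close>

lemma optimal_plan_if_contact:
  assumes fin: "finite_measure \<mu>" "finite_measure \<nu>"
    and \<pi>: "\<pi> \<in> couplings \<mu> \<nu>"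
    and meas: "f \<in> borel_measurable \<mu>" "g \<in> borel_measurable \<nu>"
    and le: "\<And>x y. x \<in> space \<mu> \<Longrightarrow> y \<in> space \<nu> \<Longrightarrow> f x + g y \<le> ereal (c (x, y))"
    and c: "\<And>z. 0 \<le> c z"
    and contact: "AE z in \<pi>. f (fst z) + g (snd z) = ereal (c z)"
  shows "optimal_plan c \<mu> \<nu> \<pi>"
    and "enn2ereal (transport_cost c \<mu> \<nu>) = ereal_integral \<pi> (\<lambda>z. f (fst z) + g (snd z))"
proof -
  have T: "(\<integral>\<^sup>+ z. ennreal (c z) \<partial>\<pi>) = transport_cost c \<mu> \<nu>"
    unfolding transport_cost_def
    using nn_integral_contact_plan_le[OF fin \<pi> _ meas le c contact]
    by (intro antisym INF_greatest INF_lower \<pi>)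
  then show "optimal_plan c \<mu> \<nu> \<pi>"
    using \<pi> by (simp add: optimal_plan_def)
  have "(\<integral>\<^sup>+ z. e2ennreal (f (fst z) + g (snd z)) \<partial>\<pi>) = (\<integral>\<^sup>+ z. ennreal (c z) \<partial>\<pi>)"
    using contact by (intro nn_integral_cong_AE) auto
  moreover have "(\<integral>\<^sup>+ z. e2ennreal (- (f (fst z) + g (snd z))) \<partial>\<pi>) = (\<integral>\<^sup>+ z. 0 \<partial>\<pi>)"
    using contact by (intro nn_integral_cong_AE, eventually_elim) (simp add: c ennreal_neg)
  ultimately show "enn2ereal (transport_cost c \<mu> \<nu>) = ereal_integral \<pi> (\<lambda>z. f (fst z) + g (snd z))"
    by (simp add: ereal_integral_def T zero_ennreal.rep_eq)
qed

text \<open>The transform over \<open>A\<close> is larger than that over the whole space, but both agree with \<open>c - f\<close> on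
  contact points over \<open>A\<close>; so \<open>f\<close> needs no modification.\<close>

lemma restricted_potential:
  fixes \<mu> :: "'a::second_countable_topology measure" and \<nu> :: "'b::second_countable_topology measure"
  assumes fin: "finite_measure \<mu>" "finite_measure \<nu>"
    and \<mu>: "sets \<mu> = sets borel" and \<nu>: "sets \<nu> = sets borel"
    and cont: "continuous_on UNIV c" and c: "\<And>z. 0 \<le> c z"
    and f: "c_concave UNIV UNIV c f"
    and \<pi>: "\<pi> \<in> couplings \<mu> \<nu>"
    and contact: "AE z in \<pi>. f (fst z) + transform_X UNIV c f (snd z) = ereal (c z)"
    and A: "A \<in> sets \<mu>" "0 < emeasure \<mu> A"
  shows "f \<in> kantorovich_potentials c (restricted_source \<mu> A) (restricted_target \<mu> \<nu> \<pi> A)"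
proof -
  let ?\<mu> = "restricted_source \<mu> A" and ?\<nu> = "restricted_target \<mu> \<nu> \<pi> A"
    and ?\<pi> = "restricted_plan \<mu> \<nu> \<pi> A" and ?g = "transform_X A c f"
  have sp: "space \<mu> = UNIV" "space \<nu> = UNIV"
    using sets_eq_imp_space_eq[OF \<mu>] sets_eq_imp_space_eq[OF \<nu>] by auto
  have sp': "space ?\<mu> = A" "space ?\<nu> = UNIV"
    by (auto simp: restricted_source_def restricted_target_def space_scale_measure space_restrict_space sp)
  obtain h where h: "\<And>y. h y \<noteq> \<infinity>" "\<And>x. f x = transform_Y UNIV c h x" and f_neq: "\<And>x. f x \<noteq> \<infinity>"
    using f unfolding c_concave_def by blast
  have f_meas [measurable]: "f \<in> borel_measurable \<mu>"
    unfolding measurable_cong_sets[OF \<mu> refl] using borel_measurable_transform_Y[OF cont, of UNIV h] h(1)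
    by (simp add: ext[of f, OF h(2)])
  have f_meas': "f \<in> borel_measurable ?\<mu>"
    using f_meas unfolding restricted_source_def
    by (auto intro: measurable_restrict_space1 cong: measurable_cong_sets)
  have "sets ?\<nu> = sets borel" by (simp add: restricted_target_def \<nu>)
  then have g_meas: "?g \<in> borel_measurable ?\<nu>"
    unfolding measurable_cong_sets[OF \<open>sets ?\<nu> = sets borel\<close> refl]
    using borel_measurable_transform_X[OF cont, of A f] f_neq by auto
  have "AE z in \<pi>. f (fst z) \<noteq> - \<infinity>"
    using contact
  proof eventually_elim
    case (elim z)
    then show ?case by (cases "transform_X UNIV c f (snd z)") auto
  qed
  then have "AE x in \<mu>. f x \<noteq> - \<infinity>"
    by (subst (asm) couplings_AE_fst_iff[OF \<pi>]) measurable
  \<comment> \<open>Contact makes f finite almost surely and A has positive mass, so f stays proper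
    on A. Both c-concavity over A and the bound on the transform over A rest on this.\<close>
  have "\<not> (\<forall>x\<in>A. f x = - \<infinity>)"
  proof
    assume "\<forall>x\<in>A. f x = - \<infinity>"
    with \<open>AE x in \<mu>. f x \<noteq> - \<infinity>\<close> have "AE x in \<mu>. x \<notin> A"
      by (auto elim!: eventually_mono)
    with A show False
      by (auto simp: AE_iff_null_sets[symmetric] null_sets_def)
  qed
  then obtain x0 where x0: "x0 \<in> A" "f x0 \<noteq> - \<infinity>" by blast
  have le: "f x + ?g y \<le> ereal (c (x, y))" if "x \<in> A" for x y
    using x0 that f_neq by (intro potential_add_transform_le transform_X_neq_PInf) auto
  have "AE z in ?\<pi>. fst z \<in> A \<and> f (fst z) + transform_X UNIV c f (snd z) = ereal (c z)"
    unfolding restricted_plan_def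
  proof (rule AE_scale_measure)
    have "A \<times> space \<nu> \<inter> space \<pi> \<in> sets \<pi>"
      using \<pi> A by (auto simp: couplings_def)
    then show "AE z in restrict_space \<pi> (A \<times> space \<nu>).
        fst z \<in> A \<and> f (fst z) + transform_X UNIV c f (snd z) = ereal (c z)"
      using contact by (subst AE_restrict_space_iff) auto
  qed
  then have contact': "AE z in ?\<pi>. f (fst z) + ?g (snd z) = ereal (c z)"
  proof eventually_elim
    case (elim z)
    have "transform_X UNIV c f (snd z) \<le> ?g (snd z)"
      unfolding transform_X_def by (intro INF_superset_mono) auto
    then have "ereal (c z) \<le> f (fst z) + ?g (snd z)"
      using elim by (metis add_left_mono)
    with elim le[of "fst z" "snd z"] show ?case by auto
  qed
  have r: "inverse (emeasure \<mu> A) \<noteq> \<infinity>"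
    using A by (auto simp: ennreal_inverse_eq_top_iff)
  have \<pi>fin: "finite_measure \<pi>"
  proof
    have "emeasure \<mu> (space \<mu>) = emeasure \<pi> (space \<pi>)"
      using emeasure_distr[OF couplings_measurable(1)[OF \<pi>] sets.top] couplings_distr[OF \<pi>]
        couplings_measurable(3)[OF \<pi>] by (simp add: sp)
    then show "emeasure \<pi> (space \<pi>) \<noteq> \<infinity>"
      using finite_measure.emeasure_finite[OF fin(1), of "space \<mu>"] by simp
  qed
  have fin': "finite_measure ?\<mu>" "finite_measure ?\<nu>"
  proof -
    show "finite_measure ?\<mu>"
      using r A finite_measure.emeasure_finite[OF fin(1), of A]
      by (intro finite_measureI) (simp add: restricted_source_def space_scale_measure
          space_restrict_space sp emeasure_restrict_space ennreal_mult_eq_top_iff)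
    have "snd \<in> measurable (restrict_space \<pi> (A \<times> space \<nu>)) \<nu>"
      using couplings_measurable[OF \<pi>] by (intro measurable_restrict_space1)
    moreover have "finite_measure (restrict_space \<pi> (A \<times> space \<nu>))"
      using \<pi> A by (intro finite_measure_restrict_space \<pi>fin) (auto simp: couplings_def)
    ultimately show "finite_measure ?\<nu>"
      using r finite_measure.emeasure_finite
      by (intro finite_measureI) (fastforce simp: restricted_target_def space_scale_measure emeasure_distr
         ennreal_mult_eq_top_iff)
  qed
  note opt = optimal_plan_if_contact[OF fin' restricted_plan_coupling[OF \<pi> A(1)] f_meas' g_meas _ c contact']
  \<comment> \<open>The restricted target still lives on all of Y, so the old witness
    \<open>h\<close> serves again.\<close>
  have "c_concave A UNIV c f"
    unfolding c_concave_def using h x0 f_neq by (auto intro!: exI[of _ h])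
  then show ?thesis
    unfolding kantorovich_potentials_def sp' case_prod_beta' using opt le sp' by blast
qed

section \<open>Constancy on components of the target support\<close>

text \<open>A finite set of reals is closed, so its preimage in S is a closed set of full measure
  and contains the support. An almost sure statement thereby holds at every point of the
  support.\<close>

lemma msupport_subset_finite_valued:
  fixes r :: "'a::topological_space \<Rightarrow> real"
  assumes "closed S" and "continuous_on S r" and "finite F" and "AE y in M. y \<in> S \<and> r y \<in> F"
  shows "msupport M \<subseteq> {y \<in> S. r y \<in> F}"
proof -
  have "closed (S \<inter> r -` F)"
    using assms by (intro continuous_closed_preimage finite_imp_closed)
  with assms(4) show ?thesis
    unfolding msupport_def by (intro Inter_lower) (auto simp: vimage_def Int_def)
qed

text \<open>A continuous real function with finitely many values on a connected set is constant. The
  alternatives differ in the connected set to which this applies: B itself, or the support of \<nu>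
  restricted to B.\<close>

lemma AE_const_on_component:
  fixes \<nu> :: "'b::second_countable_topology measure"
  assumes \<nu>: "sets \<nu> = sets borel" and B: "B \<in> components (msupport \<nu>)"
    and F: "finite F" "AE y in \<nu>. \<exists>t\<in>F. g1 y - g2 y = ereal t"
    and cont: "real_continuous_on (msupport \<nu>) g1 \<and> real_continuous_on (msupport \<nu>) g2 \<or>
      real_continuous_on B g1 \<and> real_continuous_on B g2 \<and> connected (msupport (restrict_space \<nu> B))"
  shows "\<exists>t. AE y in \<nu>. y \<in> B \<longrightarrow> g1 y - g2 y = ereal t"
proof -
  have continuous_diff: "\<exists>r. continuous_on S r \<and> (\<forall>y\<in>S. g1 y - g2 y = ereal (r y))"
    if g: "real_continuous_on S g1" "real_continuous_on S g2" for S
  proof -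
    obtain r1 r2 where "continuous_on S r1" "continuous_on S r2"
      "\<forall>y\<in>S. g1 y = ereal (r1 y)" "\<forall>y\<in>S. g2 y = ereal (r2 y)"
      using g unfolding real_continuous_on_def by blast
    then show ?thesis
      by (intro exI[of _ "\<lambda>y. r1 y - r2 y"]) (auto intro: continuous_on_diff)
  qed
  have const: "\<exists>t. \<forall>y\<in>S. r y = t"
    if "connected S" "continuous_on S r" "r ` S \<subseteq> F" for S and r :: "'b \<Rightarrow> real"
    using continuous_finite_range_constant[OF that(1,2) finite_subset[OF that(3) F(1)]]
    by (auto simp: constant_on_def)
  have B_closed: "closed B" and B_sub: "B \<subseteq> msupport \<nu>" and B_conn: "connected B"
    using closed_components[OF closed_msupport B] in_components_subset[OF B] in_components_connected[OF B]
    by auto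
  have B_sets: "B \<inter> space \<nu> \<in> sets \<nu>"
    using B_closed by (simp add: \<nu>)
  from cont show ?thesis
  proof (elim disjE conjE)
    assume "real_continuous_on (msupport \<nu>) g1" "real_continuous_on (msupport \<nu>) g2"
    then obtain r where r: "continuous_on (msupport \<nu>) r" "\<forall>y\<in>msupport \<nu>. g1 y - g2 y = ereal (r y)"
      using continuous_diff by blast
    have "AE y in \<nu>. y \<in> msupport \<nu> \<and> r y \<in> F"
      using F(2) AE_in_msupport[of \<nu>] by eventually_elim (use r(2) in auto)
    then have "msupport \<nu> \<subseteq> {y \<in> msupport \<nu>. r y \<in> F}"
      using closed_msupport r(1) F(1) by (intro msupport_subset_finite_valued)
    then obtain t where "\<forall>y\<in>B. r y = t"
      using const[OF B_conn continuous_on_subset[OF r(1) B_sub]] B_sub by auto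
    with r(2) B_sub show ?thesis
      by (intro exI[of _ t] AE_I2) auto
  next
    \<comment> \<open>Continuity on B alone controls the values only on this support, which may be a
      proper subset of B and so need not inherit connectedness from it.\<close>
    let ?S = "msupport (restrict_space \<nu> B)"
    assume "real_continuous_on B g1" "real_continuous_on B g2" and conn: "connected ?S"
    then obtain r where r: "continuous_on B r" "\<forall>y\<in>B. g1 y - g2 y = ereal (r y)"
      using continuous_diff by blast
    have "AE y in restrict_space \<nu> B. y \<in> B \<and> r y \<in> F"
      using F(2) r(2) by (subst AE_restrict_space_iff[OF B_sets]) (auto elim!: eventually_mono)
    then have sub: "?S \<subseteq> {y \<in> B. r y \<in> F}"
      using B_closed r(1) F(1) by (intro msupport_subset_finite_valued)
    then obtain t where t: "\<forall>y\<in>?S. r y = t"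
      using const[OF conn continuous_on_subset[OF r(1)]] by blast
    have "AE y in \<nu>. y \<in> B \<longrightarrow> y \<in> ?S"
      using AE_in_msupport[of "restrict_space \<nu> B"] AE_restrict_space_iff[OF B_sets] by simp
    then have "AE y in \<nu>. y \<in> B \<longrightarrow> g1 y - g2 y = ereal t"
      by eventually_elim (use t r(2) in auto)
    then show ?thesis by blast
  qed
qed

section \<open>Masses of components and non-degeneracy\<close>

text \<open>Countable additivity for the unordered sums in \<open>degenerate_plan\<close>. An
  infinite index set is enumerated bijectively by the naturals, hence the separate finite
  case.\<close>

lemma infsum_emeasure:
  assumes X: "\<And>i. i \<in> I \<Longrightarrow> X i \<in> sets M" and I: "countable I" and disj: "disjoint_family_on X I"
  shows "(\<Sum>\<^sub>\<infinity>i\<in>I. emeasure M (X i)) = emeasure M (\<Union>i\<in>I. X i)"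
proof (cases "finite I")
  case True
  then show ?thesis
    using sum_emeasure[of X I M] X disj by (auto simp: image_subset_iff)
next
  case False
  let ?e = "from_nat_into I"
  have e: "bij_betw ?e UNIV I"
    using False I by (simp add: bij_betw_from_nat_into)
  have "((\<lambda>n. emeasure M (X (?e n))) has_sum (\<Sum>\<^sub>\<infinity>n. emeasure M (X (?e n)))) UNIV"
    by (intro has_sum_infsum nonneg_summable_on_complete) simp
  then have "(\<Sum>\<^sub>\<infinity>n. emeasure M (X (?e n))) = (\<Sum>n. emeasure M (X (?e n)))"
    by (intro sums_unique has_sum_imp_sums)
  also have "\<dots> = emeasure M (\<Union>n. X (?e n))"
  proof (rule suminf_emeasure)
    show "range (\<lambda>n. X (?e n)) \<subseteq> sets M"
      using X e by (auto simp: bij_betw_def)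
    show "disjoint_family (\<lambda>n. X (?e n))"
      using disj e unfolding disjoint_family_on_def bij_betw_def inj_on_def by blast
  qed
  also have "(\<Union>n. X (?e n)) = (\<Union>i\<in>?e ` UNIV. X i)"
    by simp
  also have "?e ` UNIV = I"
    using e by (simp add: bij_betw_def)
  finally show ?thesis
    using infsum_reindex_bij_betw[OF e, of "\<lambda>i. emeasure M (X i)"] by simp
qed

text \<open>Components of the closed support are closed, hence measurable, and countably many null
  components can be discarded together.\<close>

lemma AE_in_component_of_positive_measure:
  fixes M :: "'a::second_countable_topology measure"
  assumes M: "sets M = sets borel" and count: "countable (components (msupport M))"
  shows "AE x in M. \<exists>A\<in>{A \<in> components (msupport M). 0 < emeasure M A}. x \<in> A"
proof -
  have "AE x in M. emeasure M A = 0 \<longrightarrow> x \<notin> A" if "A \<in> components (msupport M)" for A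
  proof (cases "emeasure M A = 0")
    case True
    have "A \<in> sets M"
      using closed_components[OF closed_msupport that] by (simp add: M)
    with True have "AE x in M. x \<notin> A"
      by (intro AE_not_in) (simp add: null_sets_def)
    then show ?thesis by eventually_elim simp
  qed simp
  then have "AE x in M. \<forall>A\<in>components (msupport M). emeasure M A = 0 \<longrightarrow> x \<notin> A"
    using count by (simp add: AE_ball_countable)
  with AE_in_msupport[of M] show ?thesis
  proof eventually_elim
    case (elim x)
    then obtain A where "A \<in> components (msupport M)" "x \<in> A"
      using Union_components[of "msupport M"] by blast
    with elim(2) show ?case
      by (intro bexI[of _ A]) (auto simp: zero_less_iff_neq_zero)
  qed
qed

text \<open>By the almost sure equivalence, the strips over \<Union>\<open>I'\<close> and over
  \<Union>\<open>J'\<close> both agree with their intersection up to null sets. All three sums in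
  \<open>degenerate_plan\<close> then equal the mass of that rectangle, so a positive mass below 1
  would be degenerate.\<close>

lemma nondegenerate_plan_full_mass:
  fixes \<mu> :: "'a::second_countable_topology measure" and \<nu> :: "'b::second_countable_topology measure"
  assumes \<mu>: "sets \<mu> = sets borel" and \<nu>: "sets \<nu> = sets borel"
    and \<pi>: "\<pi> \<in> couplings \<mu> \<nu>" and nondeg: "\<not> degenerate_plan \<mu> \<nu> \<pi>"
    and I': "I' \<subseteq> components (msupport \<mu>)" "countable I'"
    and J': "J' \<subseteq> components (msupport \<nu>)" "countable J'"
    and AE: "AE z in \<pi>. fst z \<in> \<Union>I' \<longleftrightarrow> snd z \<in> \<Union>J'"
    and pos: "0 < emeasure \<mu> (\<Union>I')"
  shows "1 \<le> emeasure \<mu> (\<Union>I')"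
proof -
  have I'_sets: "A \<in> sets \<mu>" if "A \<in> I'" for A
    using closed_components[OF closed_msupport, of A] that I'(1) by (auto simp: \<mu>)
  have J'_sets: "B \<in> sets \<nu>" if "B \<in> J'" for B
    using closed_components[OF closed_msupport, of B] that J'(1) by (auto simp: \<nu>)
  have UI: "\<Union>I' \<in> sets \<mu>" and UJ: "\<Union>J' \<in> sets \<nu>"
    using I'_sets J'_sets I'(2) J'(2) by (auto intro!: sets.countable_Union)
  have disj: "disjoint_family_on (\<lambda>A. A) I'" "disjoint_family_on (\<lambda>B. B) J'"
    using I'(1) J'(1) components_nonoverlap unfolding disjoint_family_on_def by blast+
  have sets_\<pi>: "A \<times> B \<in> sets \<pi>" if "A \<in> sets \<mu>" "B \<in> sets \<nu>" for A B
    using \<pi> that by (auto simp: couplings_def)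
  have sp: "space \<pi> = space \<mu> \<times> space \<nu>"
    by (rule couplings_measurable[OF \<pi>])
  have 1: "(\<Sum>\<^sub>\<infinity>A\<in>I'. emeasure \<mu> A) = emeasure \<mu> (\<Union>I')"
    using infsum_emeasure[of I' "\<lambda>A. A" \<mu>] I'_sets I'(2) disj by simp
  have 2: "(\<Sum>\<^sub>\<infinity>B\<in>J'. emeasure \<nu> B) = emeasure \<nu> (\<Union>J')"
    using infsum_emeasure[of J' "\<lambda>B. B" \<nu>] J'_sets J'(2) disj by simp
  have "(\<Sum>\<^sub>\<infinity>B\<in>J'. emeasure \<pi> (A \<times> B)) = emeasure \<pi> (A \<times> \<Union>J')" if "A \<in> I'" for A
  proof -
    have "(\<Sum>\<^sub>\<infinity>B\<in>J'. emeasure \<pi> (A \<times> B)) = emeasure \<pi> (\<Union>B\<in>J'. A \<times> B)"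
    proof (rule infsum_emeasure)
      show "disjoint_family_on (\<lambda>B. A \<times> B) J'"
        using disj(2) unfolding disjoint_family_on_def by blast
    qed (use I'_sets J'_sets sets_\<pi> J'(2) that in auto)
    also have "(\<Union>B\<in>J'. A \<times> B) = A \<times> \<Union>J'"
      by auto
    finally show ?thesis .
  qed
  then have "(\<Sum>\<^sub>\<infinity>A\<in>I'. \<Sum>\<^sub>\<infinity>B\<in>J'. emeasure \<pi> (A \<times> B)) = (\<Sum>\<^sub>\<infinity>A\<in>I'. emeasure \<pi> (A \<times> \<Union>J'))"
    by (intro infsum_cong)
  also have "\<dots> = emeasure \<pi> (\<Union>A\<in>I'. A \<times> \<Union>J')"
  proof (rule infsum_emeasure)
    show "disjoint_family_on (\<lambda>A. A \<times> \<Union>J') I'"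
      using disj(1) unfolding disjoint_family_on_def by blast
  qed (use I'_sets sets_\<pi> UJ I'(2) in auto)
  also have "(\<Union>A\<in>I'. A \<times> \<Union>J') = \<Union>I' \<times> \<Union>J'"
    by auto
  finally have 3: "(\<Sum>\<^sub>\<infinity>A\<in>I'. \<Sum>\<^sub>\<infinity>B\<in>J'. emeasure \<pi> (A \<times> B)) = emeasure \<pi> (\<Union>I' \<times> \<Union>J')" .
  have "emeasure \<mu> (\<Union>I') = emeasure \<pi> (fst -` \<Union>I' \<inter> space \<pi>)"
    using emeasure_distr[OF couplings_measurable(1)[OF \<pi>] UI] couplings_distr[OF \<pi>] by simp
  also have "\<dots> = emeasure \<pi> (\<Union>I' \<times> \<Union>J')"
  proof (rule emeasure_eq_AE)
    show "AE z in \<pi>. z \<in> fst -` \<Union>I' \<inter> space \<pi> \<longleftrightarrow> z \<in> \<Union>I' \<times> \<Union>J'"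
      using AE AE_space by eventually_elim (auto simp: mem_Times_iff)
  qed (use sets_\<pi> UI UJ measurable_sets[OF couplings_measurable(1)[OF \<pi>]] in auto)
  finally have 4: "emeasure \<mu> (\<Union>I') = emeasure \<pi> (\<Union>I' \<times> \<Union>J')" .
  have "emeasure \<nu> (\<Union>J') = emeasure \<pi> (snd -` \<Union>J' \<inter> space \<pi>)"
    using emeasure_distr[OF couplings_measurable(2)[OF \<pi>] UJ] couplings_distr[OF \<pi>] by simp
  also have "\<dots> = emeasure \<pi> (\<Union>I' \<times> \<Union>J')"
  proof (rule emeasure_eq_AE)
    show "AE z in \<pi>. z \<in> snd -` \<Union>J' \<inter> space \<pi> \<longleftrightarrow> z \<in> \<Union>I' \<times> \<Union>J'"
      using AE AE_space by eventually_elim (auto simp: mem_Times_iff)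
  qed (use sets_\<pi> UI UJ measurable_sets[OF couplings_measurable(2)[OF \<pi>]] in auto)
  finally have 5: "emeasure \<nu> (\<Union>J') = emeasure \<pi> (\<Union>I' \<times> \<Union>J')" .
  show ?thesis
  proof (rule ccontr)
    assume "\<not> ?thesis"
    then have "degenerate_plan \<mu> \<nu> \<pi>"
      unfolding degenerate_plan_def using I'(1) J'(1) pos 1 2 3 4 5
      by (intro exI[of _ I'] exI[of _ J'] conjI) (simp_all add: not_le)
    with nondeg show False ..
  qed
qed

section \<open>From the restricted problems to the whole problem\<close>

text \<open>Since the mass of A is positive and finite, scaling by it undoes the
  normalisation.\<close>

lemma AE_restricted_source:
  assumes A: "A \<in> sets \<mu>" "0 < emeasure \<mu> A" "emeasure \<mu> A < \<infinity>"
    and AE: "AE x in restricted_source \<mu> A. P x"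
  shows "AE x in \<mu>. x \<in> A \<longrightarrow> P x"
proof -
  have "emeasure \<mu> A * inverse (emeasure \<mu> A) = 1"
    using A ennreal_divide_self[of "emeasure \<mu> A"] by (simp add: divide_ennreal_def)
  then have "restrict_space \<mu> A = scale_measure (emeasure \<mu> A) (restricted_source \<mu> A)"
    by (simp add: restricted_source_def)
  then have "AE x in restrict_space \<mu> A. P x"
    using AE_scale_measure[OF AE] by metis
  then show ?thesis
    using A(1) by (simp add: AE_restrict_space_iff)
qed

text \<open>Finite sums force all four terms to be finite. At a contact point shared by two
  potentials, this transfers their difference to the transforms with opposite sign.\<close>

lemma ereal_diff_eq_uminus_if_sum_eq:
  fixes a b a' b' :: ereal
  assumes "a + b = ereal t" "a' + b' = ereal t" "a - a' = ereal k"
  shows "b - b' = ereal (- k)"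
  using assms by (cases a; cases b; cases a'; cases b') auto

theorem theorem2:
  fixes \<mu> :: "'a::polish_space measure" and \<nu> :: "'b::polish_space measure"
    and c :: "'a \<times> 'b \<Rightarrow> real"
  assumes "prob_space \<mu>" and "sets \<mu> = sets borel"
    and "prob_space \<nu>" and "sets \<nu> = sets borel"
    and "continuous_on UNIV c" and "\<And>z. 0 \<le> c z"
    and "transport_cost c \<mu> \<nu> < \<infinity>"
    and "finite (components (msupport \<mu>))" and "countable (components (msupport \<nu>))"
    and "\<And>f. f \<in> kantorovich_potentials c \<mu> \<nu> \<Longrightarrow>
           real_continuous_on (msupport \<nu>) (transform_X UNIV c f) \<or>
           (\<forall>B\<in>components (msupport \<nu>). emeasure \<nu> B > 0 \<longrightarrow>
              real_continuous_on B (transform_X UNIV c f) \<and>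
              connected (msupport (restrict_space \<nu> B)))"
    and "\<exists>\<pi>. optimal_plan c \<mu> \<nu> \<pi> \<and> \<not> degenerate_plan \<mu> \<nu> \<pi> \<and>
           (\<forall>A\<in>components (msupport \<mu>).
              unique_potentials c (restricted_source \<mu> A) (restricted_target \<mu> \<nu> \<pi> A))"
  shows "unique_potentials c \<mu> \<nu>"
  unfolding unique_potentials_def
proof (intro ballI)
  fix f1 f2 assume f: "f1 \<in> kantorovich_potentials c \<mu> \<nu>" "f2 \<in> kantorovich_potentials c \<mu> \<nu>"
  interpret \<mu>: prob_space \<mu> by fact
  interpret \<nu>: prob_space \<nu> by fact
  note \<mu> = assms(2) and \<nu> = assms(4) and cont = assms(5) and c = assms(6)
  note fin = \<mu>.finite_measure_axioms \<nu>.finite_measure_axioms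
  have sp: "space \<mu> = UNIV" "space \<nu> = UNIV"
    using sets_eq_imp_space_eq[OF \<mu>] sets_eq_imp_space_eq[OF \<nu>] by auto
  obtain \<pi> where opt: "optimal_plan c \<mu> \<nu> \<pi>" and nondeg: "\<not> degenerate_plan \<mu> \<nu> \<pi>"
    and uniq: "\<And>A. A \<in> components (msupport \<mu>) \<Longrightarrow>
      unique_potentials c (restricted_source \<mu> A) (restricted_target \<mu> \<nu> \<pi> A)"
    using assms(11) by blast
  have \<pi>: "\<pi> \<in> couplings \<mu> \<nu>"
    using opt by (simp add: optimal_plan_def)
  \<comment> \<open>Positive mass is what normalising on a component of \<open>supp \<mu>\<close>
    and the second continuity alternative on a component of \<open>supp \<nu>\<close> require; the
    other components are covered by null sets.\<close>
  let ?X = "{A \<in> components (msupport \<mu>). 0 < emeasure \<mu> A}"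
    and ?Y = "{B \<in> components (msupport \<nu>). 0 < emeasure \<nu> B}"
  have X_fin: "finite ?X" and Y_count: "countable ?Y"
    using assms(8,9) by (auto intro: countable_subset[rotated])
  have X_sets: "A \<in> sets \<mu>" if "A \<in> components (msupport \<mu>)" for A
    using closed_components[OF closed_msupport that] by (simp add: \<mu>)
  have Y_sets: "B \<in> sets \<nu>" if "B \<in> components (msupport \<nu>)" for B
    using closed_components[OF closed_msupport that] by (simp add: \<nu>)
  define g1 g2 where "g1 = transform_X UNIV c f1" and "g2 = transform_X UNIV c f2"
  have contact: "AE z in \<pi>. f1 (fst z) + g1 (snd z) = ereal (c z)"
    "AE z in \<pi>. f2 (fst z) + g2 (snd z) = ereal (c z)"
    unfolding g1_def g2_def using kantorovich_potential_contact[OF fin \<mu> \<nu> cont c assms(7)] f opt by auto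
  have cc: "c_concave UNIV UNIV c f1" "c_concave UNIV UNIV c f2"
    using f by (auto simp: kantorovich_potentials_def sp)

  have "\<exists>k. AE x in \<mu>. x \<in> A \<longrightarrow> f1 x - f2 x = ereal k" if "A \<in> ?X" for A
  proof -
    have A: "A \<in> sets \<mu>" "0 < emeasure \<mu> A" using X_sets that by auto
    note pot = restricted_potential[OF fin \<mu> \<nu> cont c _ \<pi> _ A]
    have "f1 \<in> kantorovich_potentials c (restricted_source \<mu> A) (restricted_target \<mu> \<nu> \<pi> A)"
      "f2 \<in> kantorovich_potentials c (restricted_source \<mu> A) (restricted_target \<mu> \<nu> \<pi> A)"
      using pot[of f1] pot[of f2] cc contact by (auto simp: g1_def g2_def)
    moreover have "unique_potentials c (restricted_source \<mu> A) (restricted_target \<mu> \<nu> \<pi> A)"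
      using uniq that by simp
    ultimately obtain k where "AE x in restricted_source \<mu> A. f1 x - f2 x = ereal k"
      unfolding unique_potentials_def by blast
    then have "AE x in \<mu>. x \<in> A \<longrightarrow> f1 x - f2 x = ereal k"
      using A by (intro AE_restricted_source) (auto simp: less_top[symmetric])
    then show ?thesis ..
  qed
  then obtain K where K: "\<And>A. A \<in> ?X \<Longrightarrow> AE x in \<mu>. x \<in> A \<longrightarrow> f1 x - f2 x = ereal (K A)"
    using bchoice[of ?X "\<lambda>A k. AE x in \<mu>. x \<in> A \<longrightarrow> f1 x - f2 x = ereal k"] by blast

  have X_ex: "AE x in \<mu>. \<exists>A\<in>?X. x \<in> A"
    using AE_in_component_of_positive_measure[OF \<mu> countable_finite[OF assms(8)]] by simp
  have Y_ex: "AE y in \<nu>. \<exists>B\<in>?Y. y \<in> B"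
    using AE_in_component_of_positive_measure[OF \<nu> assms(9)] by simp
  have "AE x in \<mu>. \<forall>A\<in>?X. x \<in> A \<longrightarrow> f1 x - f2 x = ereal (K A)"
    using X_fin K by (intro AE_ball_countable[THEN iffD2]) (auto intro: countable_finite)
  from couplings_AE_fst[OF \<pi> this] contact
  have g_diff: "AE z in \<pi>. \<forall>A\<in>?X. fst z \<in> A \<longrightarrow> g1 (snd z) - g2 (snd z) = ereal (- K A)"
    by eventually_elim (metis ereal_diff_eq_uminus_if_sum_eq)

  \<comment> \<open>Here finiteness of the decomposition of \<open>supp \<mu>\<close> enters: the
    difference of the transforms has only finitely many almost sure values.\<close>
  define F where "F = (\<lambda>A. - K A) ` ?X"
  have F_fin: "finite F" using X_fin by (simp add: F_def)
  have "AE z in \<pi>. \<exists>t\<in>F. g1 (snd z) - g2 (snd z) = ereal t"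
    using g_diff couplings_AE_fst[OF \<pi> X_ex] by eventually_elim (auto simp: F_def)
  \<comment> \<open>Measurability of this set lets the almost sure statement descend from \<pi> to
    \<nu>.\<close>
  moreover have "{y \<in> space \<nu>. \<exists>t\<in>F. g1 y - g2 y = ereal t} \<in> sets \<nu>"
  proof -
    have [measurable]: "g1 \<in> borel_measurable \<nu>" "g2 \<in> borel_measurable \<nu>"
      using cc borel_measurable_transform_X[OF cont, of UNIV]
      unfolding measurable_cong_sets[OF \<nu> refl] g1_def g2_def by (auto simp: c_concave_def)
    note [measurable] = countable_finite[OF F_fin]
    show ?thesis by measurable
  qed
  ultimately have g_fin: "AE y in \<nu>. \<exists>t\<in>F. g1 y - g2 y = ereal t"
    by (subst (asm) couplings_AE_snd_iff[OF \<pi>])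
  have "\<exists>t. AE y in \<nu>. y \<in> B \<longrightarrow> g1 y - g2 y = ereal t" if "B \<in> ?Y" for B
  proof (rule AE_const_on_component[OF \<nu> _ F_fin g_fin])
    \<comment> \<open>The two potentials may fall under different alternatives. Restricting
      continuity from the whole support to B settles the mixed case under the second one.\<close>
    have "real_continuous_on B h" if "real_continuous_on (msupport \<nu>) h" for h
      using that in_components_subset[of B "msupport \<nu>"] \<open>B \<in> ?Y\<close>
      unfolding real_continuous_on_def by (blast intro: continuous_on_subset)
    with assms(10)[OF f(1)] assms(10)[OF f(2)] that
    show "real_continuous_on (msupport \<nu>) g1 \<and> real_continuous_on (msupport \<nu>) g2 \<or>
      real_continuous_on B g1 \<and> real_continuous_on B g2 \<and> connected (msupport (restrict_space \<nu> B))"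
      unfolding g1_def g2_def by blast
  qed (use that in simp)
  then obtain H where H: "\<And>B. B \<in> ?Y \<Longrightarrow> AE y in \<nu>. y \<in> B \<longrightarrow> g1 y - g2 y = ereal (H B)"
    using bchoice[of ?Y "\<lambda>B t. AE y in \<nu>. y \<in> B \<longrightarrow> g1 y - g2 y = ereal t"] by blast
  have H_all: "AE y in \<nu>. \<forall>B\<in>?Y. y \<in> B \<longrightarrow> g1 y - g2 y = ereal (H B)"
    using Y_count H by (intro AE_ball_countable[THEN iffD2]) auto

  have "?X \<noteq> {}"
  proof
    assume "?X = {}"
    with X_ex have "AE x in \<mu>. False"
      by (simp only: bex_empty)
    then show False by simp
  qed
  then obtain A0 where A0: "A0 \<in> ?X"
    by blast
  \<comment> \<open>Different components may share a constant, so whole level sets are collected.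
    Almost surely, membership of either coordinate in its union then becomes the same equation
    \<open>g1 - g2 = - K A0\<close> at \<open>snd z\<close>.\<close>
  define I' J' where "I' = {A \<in> ?X. K A = K A0}" and "J' = {B \<in> ?Y. H B = - K A0}"
  have I': "I' \<subseteq> components (msupport \<mu>)" "countable I'" and J': "J' \<subseteq> components (msupport \<nu>)" "countable J'"
    using X_fin Y_count by (auto simp: I'_def J'_def intro: countable_finite countable_subset[rotated])
  have "AE z in \<pi>. fst z \<in> \<Union>I' \<longleftrightarrow> snd z \<in> \<Union>J'"
    using g_diff couplings_AE_fst[OF \<pi> X_ex] couplings_AE_snd[OF \<pi> Y_ex] couplings_AE_snd[OF \<pi> H_all]
  proof eventually_elim
    case (elim z)
    obtain A B where AB: "A \<in> ?X" "fst z \<in> A" "B \<in> ?Y" "snd z \<in> B"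
      using elim(2,3) by blast
    have "fst z \<in> \<Union>I' \<longleftrightarrow> g1 (snd z) - g2 (snd z) = ereal (- K A0)"
      using elim(1) AB(1,2) unfolding I'_def by fastforce
    moreover have "snd z \<in> \<Union>J' \<longleftrightarrow> g1 (snd z) - g2 (snd z) = ereal (- K A0)"
      using elim(4) AB(3,4) unfolding J'_def by fastforce
    ultimately show ?case by blast
  qed
  moreover have UI: "\<Union>I' \<in> sets \<mu>"
    using I' X_sets by (intro sets.countable_Union) auto
  moreover have "0 < emeasure \<mu> (\<Union>I')"
  proof -
    have "emeasure \<mu> A0 \<le> emeasure \<mu> (\<Union>I')"
      using A0 UI by (intro emeasure_mono) (auto simp: I'_def)
    with A0 show ?thesis by auto
  qed
  ultimately have "1 \<le> emeasure \<mu> (\<Union>I')"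
    using nondegenerate_plan_full_mass[OF \<mu> \<nu> \<pi> nondeg I' J'] by blast
  then have "\<mu>.prob (\<Union>I') = 1"
    by (simp add: \<mu>.emeasure_eq_measure antisym)
  then have "AE x in \<mu>. x \<in> \<Union>I'"
    by (rule \<mu>.AE_prob_1)
  moreover have "AE x in \<mu>. \<forall>A\<in>?X. x \<in> A \<longrightarrow> f1 x - f2 x = ereal (K A)"
    by fact
  ultimately have "AE x in \<mu>. f1 x - f2 x = ereal (K A0)"
    by eventually_elim (auto simp: I'_def)
  then show "\<exists>k. AE x in \<mu>. f1 x - f2 x = ereal k" ..
qed

end
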